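(* Let $\mathcal H_{i},\mathcal H_{o}$ be finite-dimensional complex Hilbert spaces, let $\widetilde P_{i}:\mathcal L(\mathcal H_i)\to\mathcal L(\mathcal H_i)$ and $\widetilde P_{o}:\mathcal L(\mathcal H_o)\to\mathcal L(\mathcal H_o)$ be linear maps with $\widetilde P_i\circ\widetilde P_i=\widetilde P_i$ and $\widetilde P_o\circ\widetilde P_o=\widetilde P_o$, let $\gamma_i,\gamma_o\in\mathbb C$ with $\gamma_i\neq 0$, and define $$\mathcal S_i=\{W\in\mathcal L(\mathcal H_i):\widetilde P_i[W]=W,\ \operatorname{tr}[W]=\gamma_i\},\qquad \mathcal S_o=\{W'\in\mathcal L(\mathcal H_o):\widetilde P_o[W']=W',\ \operatorname{tr}[W']=\gamma_o\}.$$ Assume $\mathcal S_i$ is nonempty. Then a linear map $\widetilde T_{io}:\mathcal L(\mathcal H_i)\to\mathcal L(\mathcal H_o)$ satisfies $\widetilde T_{io}[W]\in\mathcal S_o$ for all $W\in\mathcal S_i$ if and only if $$\widetilde P_o\circ\widetilde T_{io}\circ\widetilde P_i=\widetilde T_{io}\circ\widetilde P_i\qquad\text{and}\qquad \operatorname{tr}\circ\,\widetilde T_{io}\circ\widetilde P_i=\frac{\gamma_o}{\gamma_i}\,\operatorname{tr}\circ\,\widetilde P_i .$$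
   Context: $\mathcal L(\mathcal H)$ denotes the space of all linear operators on the finite-dimensional complex Hilbert space $\mathcal H$; $\operatorname{tr}$ is the trace, viewed as a linear functional. *)

theory Defs
  imports "HOL-Analysis.Analysis"
begin

class complex_vector_space = ab_group_add +
  fixes scaleC :: "complex \<Rightarrow> 'a \<Rightarrow> 'a" (infixr "*\<^sub>C" 75)
  assumes scaleC_add_right: "a *\<^sub>C (x + y) = a *\<^sub>C x + a *\<^sub>C y"
    and scaleC_add_left: "(a + b) *\<^sub>C x = a *\<^sub>C x + b *\<^sub>C x"
    and scaleC_scaleC: "a *\<^sub>C b *\<^sub>C x = (a * b) *\<^sub>C x"
    and scaleC_one: "1 *\<^sub>C x = x"

global_interpretation complex_vs: vector_space "scaleC :: complex \<Rightarrow> 'a \<Rightarrow> 'a::complex_vector_space"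
  by unfold_locales (rule scaleC_add_right scaleC_add_left scaleC_scaleC scaleC_one)+

text \<open>The library's \<open>linear\<close> is real-linearity.\<close>

abbreviation clinear :: "('a::complex_vector_space \<Rightarrow> 'b::complex_vector_space) \<Rightarrow> bool"
  where "clinear \<equiv> Vector_Spaces.linear scaleC scaleC"

lemma clinearI:
  assumes "\<And>x y. f (x + y) = f x + f y" "\<And>a x. f (a *\<^sub>C x) = a *\<^sub>C f x"
  shows "clinear f"
  using assms by (simp add: Vector_Spaces.linear_iff complex_vs.vector_space_axioms)

lemma clinear_add: "clinear f \<Longrightarrow> f (x + y) = f x + f y"
  and clinear_scaleC: "clinear f \<Longrightarrow> f (a *\<^sub>C x) = a *\<^sub>C f x"
  by (simp_all add: Vector_Spaces.linear_iff)

lemma clinear_sum: "clinear f \<Longrightarrow> f (\<Sum>i\<in>I. g i) = (\<Sum>i\<in>I. f (g i))"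
  using module_hom.sum[of scaleC scaleC f g I] module_hom_iff_linear[of scaleC scaleC f] by simp

text \<open>The inner product is conjugate-linear in the first argument. Completeness is not required,
  since a finite-dimensional inner product space is complete. Dimension zero is allowed.\<close>

class fd_chilbert = complex_vector_space +
  fixes cinner :: "'a \<Rightarrow> 'a \<Rightarrow> complex"
  assumes cinner_cnj: "cinner x y = cnj (cinner y x)"
    and cinner_add_right: "cinner x (y + z) = cinner x y + cinner x z"
    and cinner_scaleC_right: "cinner x (a *\<^sub>C y) = a * cinner x y"
    and cinner_pos: "x \<noteq> 0 \<Longrightarrow> cinner x x \<in> \<real> \<and> Re (cinner x x) > 0"
    and finite_dimensional: "\<exists>B. finite B \<and> (\<forall>x. \<exists>c. x = (\<Sum>b\<in>B. c b *\<^sub>C b))"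
begin

definition orthonormal :: "'a set \<Rightarrow> bool"
  where "orthonormal E \<longleftrightarrow> (\<forall>e\<in>E. \<forall>f\<in>E. cinner e f = (if e = f then 1 else 0))"

end

definition orthonormal_basis :: "'a::fd_chilbert set \<Rightarrow> bool"
  where "orthonormal_basis E \<longleftrightarrow> orthonormal E \<and> finite E \<and> complex_vs.span E = UNIV"

lemma cinner_sum_right: "cinner (x::'a::fd_chilbert) (\<Sum>i\<in>I. g i) = (\<Sum>i\<in>I. cinner x (g i))"
proof -
  have "cinner x 0 = 0"
    using cinner_add_right[of x 0 0] by simp
  then show ?thesis
    by (induction I rule: infinite_finite_induct) (simp_all add: cinner_add_right)
qed

lemma cinner_diff_right: "cinner (x::'a::fd_chilbert) (y - z) = cinner x y - cinner x z"
  using cinner_add_right[of x "y - z" z] by simp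

lemma finite_spanning_set: "\<exists>B::'a::fd_chilbert set. finite B \<and> complex_vs.span B = UNIV"
proof -
  obtain B :: "'a set" where B: "finite B" "\<And>x. \<exists>c. x = (\<Sum>b\<in>B. c b *\<^sub>C b)"
    using finite_dimensional by blast
  have "(\<Sum>b\<in>B. c b *\<^sub>C b) \<in> complex_vs.span B" for c
    by (intro complex_vs.span_sum complex_vs.span_scale complex_vs.span_base)
  then have "x \<in> complex_vs.span B" for x
    using B(2)[of x] by force
  with B(1) show ?thesis by blast
qed

lemma cinner_orthonormal_sum:
  fixes E :: "'a::fd_chilbert set"
  assumes "orthonormal E" "finite T" "T \<subseteq> E" "e \<in> T"
  shows "cinner e (\<Sum>f\<in>T. c f *\<^sub>C f) = c e"
proof -
  have "cinner e (\<Sum>f\<in>T. c f *\<^sub>C f) = (\<Sum>f\<in>T. c f * cinner e f)"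
    by (simp add: cinner_sum_right cinner_scaleC_right)
  also have "\<dots> = (\<Sum>f\<in>T. if f = e then c f else 0)"
    by (rule sum.cong) (use assms in \<open>auto simp: orthonormal_def subset_iff\<close>)
  also have "\<dots> = c e"
    using assms by simp
  finally show ?thesis .
qed

lemma orthonormal_independent:
  fixes E :: "'a::fd_chilbert set"
  assumes "orthonormal E"
  shows "complex_vs.independent E"
  unfolding complex_vs.independent_explicit_module
proof (intro allI impI)
  fix T c v
  assume T: "finite T" "T \<subseteq> E" "(\<Sum>v\<in>T. c v *\<^sub>C v) = 0" "v \<in> T"
  have "c v = cinner v (\<Sum>v\<in>T. c v *\<^sub>C v)"
    using cinner_orthonormal_sum[OF assms T(1,2,4)] by simp
  also have "\<dots> = 0"
    using T(3) cinner_add_right[of v 0 0] by simp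
  finally show "c v = 0" .
qed

lemma orthonormal_basis_exists: "\<exists>E::'a::fd_chilbert set. orthonormal_basis E"
proof -
  obtain B :: "'a set" where B: "finite B" "complex_vs.span B = UNIV"
    using finite_spanning_set by blast
  have bound: "finite E \<and> card E \<le> card B" if "orthonormal E" for E :: "'a set"
    using complex_vs.independent_span_bound[OF B(1) orthonormal_independent[OF that]] B(2) by simp
  have "orthonormal ({}::'a set)"
    by (simp add: orthonormal_def)
  then obtain E :: "'a set" where E: "orthonormal E" "\<And>F::'a set. orthonormal F \<Longrightarrow> card F \<le> card E"
    using ex_has_greatest_nat[of orthonormal "{}" card "Suc (card B)"] bound
    by (metis le_imp_less_Suc)
  have fin: "finite E"
    using bound E(1) by blast
  have "x \<in> complex_vs.span E" for x
  proof (rule ccontr)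
    assume x: "x \<notin> complex_vs.span E"
    define p where "p = (\<Sum>e\<in>E. cinner e x *\<^sub>C e)"
    define y where "y = x - p"
    have p: "p \<in> complex_vs.span E"
      unfolding p_def by (intro complex_vs.span_sum complex_vs.span_scale complex_vs.span_base)
    have "y \<noteq> 0"
      using x p by (auto simp: y_def)
    define r where "r = Re (cinner y y)"
    have r: "r > 0" "cinner y y = of_real r"
      using cinner_pos[OF \<open>y \<noteq> 0\<close>] by (auto simp: r_def complex_is_Real_iff complex_eq_iff)
    define u where "u = of_real (1 / sqrt r) *\<^sub>C y"
    have orth: "cinner e u = 0" "cinner u e = 0" if "e \<in> E" for e
    proof -
      show "cinner e u = 0"
        using cinner_orthonormal_sum[OF E(1) fin subset_refl that, of "\<lambda>e. cinner e x"]
        by (simp add: u_def y_def p_def cinner_scaleC_right cinner_diff_right)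
      then show "cinner u e = 0"
        using cinner_cnj[of u e] by simp
    qed
    have "cinner u u = of_real (1 / sqrt r) * cinner u y"
      unfolding u_def by (rule cinner_scaleC_right)
    also have "cinner u y = cnj (of_real (1 / sqrt r) * cinner y y)"
      using cinner_cnj[of u y] by (simp add: u_def cinner_scaleC_right)
    also have "of_real (1 / sqrt r) * cnj (of_real (1 / sqrt r) * cinner y y)
        = of_real (1 / sqrt r * (1 / sqrt r) * r)"
      unfolding r(2) complex_cnj_mult complex_cnj_complex_of_real of_real_mult by (simp only: mult.assoc)
    also have "1 / sqrt r * (1 / sqrt r) * r = 1"
      using r(1) by (simp add: field_simps)
    finally have uu: "cinner u u = 1"
      by simp
    have "u \<notin> E"
      using orth(1)[of u] uu by auto
    have "orthonormal (insert u E)"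
      using E(1) orth uu \<open>u \<notin> E\<close> by (auto simp: orthonormal_def)
    from E(2)[OF this] show False
      using fin \<open>u \<notin> E\<close> by simp
  qed
  then show ?thesis
    using E(1) fin by (auto simp: orthonormal_basis_def)
qed

lemma orthonormal_basis_expansion:
  fixes E :: "'a::fd_chilbert set"
  assumes "orthonormal_basis E"
  shows "x = (\<Sum>e\<in>E. cinner e x *\<^sub>C e)"
proof -
  have E: "orthonormal E" "finite E" "complex_vs.span E = UNIV"
    using assms by (auto simp: orthonormal_basis_def)
  then obtain c where c: "x = (\<Sum>e\<in>E. c e *\<^sub>C e)"
    using complex_vs.span_finite[OF E(2)] by blast
  have "cinner e x = c e" if "e \<in> E" for e
    unfolding c by (rule cinner_orthonormal_sum[OF E(1,2) subset_refl that])
  then show ?thesis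
    using c by simp
qed

typedef (overloaded) 'h operator = "{f :: 'h::fd_chilbert \<Rightarrow> 'h. clinear f}"
  morphisms apply_op Operator
  by (rule exI[of _ "\<lambda>x. x"]) (simp add: clinearI)

setup_lifting type_definition_operator

lemma clinear_apply_op: "clinear (apply_op A)"
  using apply_op[of A] by simp

instantiation operator :: (fd_chilbert) complex_vector_space
begin

lift_definition zero_operator :: "'a operator" is "\<lambda>x. 0"
  by (rule clinearI) simp_all

lift_definition plus_operator :: "'a operator \<Rightarrow> 'a operator \<Rightarrow> 'a operator" is "\<lambda>f g x. f x + g x"
  by (rule clinearI) (simp_all add: clinear_add clinear_scaleC complex_vs.scale_right_distrib)

lift_definition minus_operator :: "'a operator \<Rightarrow> 'a operator \<Rightarrow> 'a operator" is "\<lambda>f g x. f x - g x"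
  by (rule clinearI) (simp_all add: clinear_add clinear_scaleC complex_vs.scale_right_diff_distrib)

lift_definition uminus_operator :: "'a operator \<Rightarrow> 'a operator" is "\<lambda>f x. - f x"
  by (rule clinearI) (simp_all add: clinear_add clinear_scaleC)

lift_definition scaleC_operator :: "complex \<Rightarrow> 'a operator \<Rightarrow> 'a operator" is "\<lambda>a f x. a *\<^sub>C f x"
  by (rule clinearI)
    (simp_all add: clinear_add clinear_scaleC complex_vs.scale_right_distrib mult.commute)

instance
  by standard (transfer; simp add: fun_eq_iff algebra_simps complex_vs.scale_right_distrib
      complex_vs.scale_left_distrib)+

end

definition tr :: "'h::fd_chilbert operator \<Rightarrow> complex"
  where "tr A = (\<Sum>e\<in>(SOME E. orthonormal_basis E). cinner e (apply_op A e))"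

lemma tr_orthonormal_basis:
  fixes A :: "'h::fd_chilbert operator"
  assumes F: "orthonormal_basis F"
  shows "tr A = (\<Sum>f\<in>F. cinner f (apply_op A f))"
proof -
  define E where "E = (SOME E::'h set. orthonormal_basis E)"
  have E: "orthonormal_basis E"
    unfolding E_def using orthonormal_basis_exists by (rule someI_ex)
  note A = clinear_apply_op[of A]
  have "cinner e (apply_op A e) = (\<Sum>f\<in>F. cinner f e * cinner e (apply_op A f))" for e
    by (subst (2) orthonormal_basis_expansion[OF F, of e])
      (simp add: clinear_sum[OF A] clinear_scaleC[OF A] cinner_sum_right cinner_scaleC_right)
  then have "tr A = (\<Sum>f\<in>F. \<Sum>e\<in>E. cinner f e * cinner e (apply_op A f))"
    unfolding tr_def E_def[symmetric] by (simp add: sum.swap[of _ E F])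
  also have "\<dots> = (\<Sum>f\<in>F. cinner f (apply_op A f))"
  proof (rule sum.cong[OF refl])
    fix f
    show "(\<Sum>e\<in>E. cinner f e * cinner e (apply_op A f)) = cinner f (apply_op A f)"
      by (subst (2) orthonormal_basis_expansion[OF E, of "apply_op A f"])
        (simp add: cinner_sum_right cinner_scaleC_right mult.commute)
  qed
  finally show ?thesis .
qed

instantiation complex :: fd_chilbert
begin

definition scaleC_complex :: "complex \<Rightarrow> complex \<Rightarrow> complex" where "scaleC_complex a x = a * x"

definition cinner_complex :: "complex \<Rightarrow> complex \<Rightarrow> complex" where "cinner_complex x y = cnj x * y"

instance
proof
  fix x :: complex
  show "cinner x x \<in> \<real> \<and> 0 < Re (cinner x x)" if "x \<noteq> 0"
    using that complex_neq_0[of x]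
    by (auto simp: cinner_complex_def complex_is_Real_iff power2_eq_square)
  have "finite {1::complex} \<and> (\<forall>x. \<exists>c. x = (\<Sum>b\<in>{1::complex}. c b *\<^sub>C b))"
    by (auto simp: scaleC_complex_def intro: exI[of _ "\<lambda>_. _"])
  then show "\<exists>B::complex set. finite B \<and> (\<forall>x. \<exists>c. x = (\<Sum>b\<in>B. c b *\<^sub>C b))"
    by blast
qed (simp_all add: scaleC_complex_def cinner_complex_def algebra_simps)

end

instantiation vec :: (complex_vector_space, finite) complex_vector_space
begin

definition scaleC_vec :: "complex \<Rightarrow> 'a ^ 'b \<Rightarrow> 'a ^ 'b" where "scaleC_vec a x = (\<chi> i. a *\<^sub>C x $ i)"

instance
  by standard (simp_all add: scaleC_vec_def vec_eq_iff complex_vs.scale_right_distrib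
      complex_vs.scale_left_distrib)

end

instantiation vec :: (fd_chilbert, finite) fd_chilbert
begin

definition cinner_vec :: "'a ^ 'b \<Rightarrow> 'a ^ 'b \<Rightarrow> complex"
  where "cinner_vec x y = (\<Sum>i\<in>UNIV. cinner (x $ i) (y $ i))"

instance
proof
  fix x y z :: "'a ^ 'b" and a :: complex
  show "cinner x y = cnj (cinner y x)"
    unfolding cinner_vec_def cnj_sum by (rule sum.cong) (simp_all add: cinner_cnj[symmetric])
  show "cinner x (y + z) = cinner x y + cinner x z"
    by (simp add: cinner_vec_def cinner_add_right sum.distrib)
  show "cinner x (a *\<^sub>C y) = a * cinner x y"
    by (simp add: cinner_vec_def scaleC_vec_def cinner_scaleC_right sum_distrib_left)
  show "cinner x x \<in> \<real> \<and> 0 < Re (cinner x x)" if "x \<noteq> 0"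
  proof -
    have nn: "cinner v v \<in> \<real> \<and> 0 \<le> Re (cinner v v)" for v :: 'a
      using cinner_pos[of v] cinner_add_right[of "0::'a" 0 0] by (cases "v = 0") auto
    obtain i where "x $ i \<noteq> 0"
      using \<open>x \<noteq> 0\<close> by (auto simp: vec_eq_iff)
    then have "0 < (\<Sum>i\<in>UNIV. Re (cinner (x $ i) (x $ i)))"
      using nn cinner_pos by (intro sum_pos2[of _ i]) auto
    then show ?thesis
      using nn by (auto simp: cinner_vec_def intro!: sum_in_Reals)
  qed
  obtain B :: "'a set" where B: "finite B" "complex_vs.span B = UNIV"
    using finite_spanning_set by blast
  define C where "C = (\<Union>i::'b. axis i ` B)"
  have lin: "clinear (axis i :: 'a \<Rightarrow> 'a ^ 'b)" for i
    by (rule clinearI) (auto simp: axis_def scaleC_vec_def vec_eq_iff)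
  have "v \<in> complex_vs.span C" for v :: "'a ^ 'b"
  proof -
    have "axis i w \<in> complex_vs.span C" for i w
    proof -
      have "axis i w \<in> axis i ` complex_vs.span B"
        using B(2) by blast
      also have "\<dots> = complex_vs.span (axis i ` B)"
        using lin[of i] by (simp add: module_hom.span_image module_hom_iff_linear)
      also have "\<dots> \<subseteq> complex_vs.span C"
        by (rule complex_vs.span_mono) (auto simp: C_def)
      finally show ?thesis .
    qed
    moreover have "v = (\<Sum>i\<in>UNIV. axis i (v $ i))"
      by (simp add: vec_eq_iff axis_def if_distrib[of "\<lambda>x. x = _"] sum.delta)
    ultimately show ?thesis
      by (metis complex_vs.span_sum)
  qed
  moreover have "finite C"
    using B(1) by (simp add: C_def)
  ultimately have "finite C \<and> (\<forall>v. \<exists>c. v = (\<Sum>b\<in>C. c b *\<^sub>C b))"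
    using complex_vs.span_finite[of C] by blast
  then show "\<exists>B::('a ^ 'b) set. finite B \<and> (\<forall>x. \<exists>c. x = (\<Sum>b\<in>B. c b *\<^sub>C b))"
    by blast
qed

end

end

theory Submission
  imports Defs
begin

text \<open>Fix \<open>W\<^sub>0 \<in> S\<^sub>i\<close>. Any \<open>Y\<close> in the range of \<open>P\<^sub>i\<close> is moved into \<open>S\<^sub>i\<close> by adding
  \<open>(1 - tr Y / \<gamma>\<^sub>i) W\<^sub>0\<close>, so the affine condition on \<open>S\<^sub>i\<close> determines \<open>T\<close> on the whole range.\<close>

text \<open>The basis picked by \<open>SOME\<close> in \<open>tr\<close> depends on the space alone,
  so all three traces are sums over the same basis and combine termwise.\<close>

lemma tr_add: "tr (A + B) = tr A + tr B"
  by (simp add: tr_def plus_operator.rep_eq cinner_add_right sum.distrib)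

lemma tr_scaleC: "tr (a *\<^sub>C A) = a * tr A"
  by (simp add: tr_def scaleC_operator.rep_eq cinner_scaleC_right sum_distrib_left)

theorem theorem1:
  fixes P\<^sub>i :: "'hi::fd_chilbert operator \<Rightarrow> 'hi operator"
    and P\<^sub>o :: "'ho::fd_chilbert operator \<Rightarrow> 'ho operator"
    and T :: "'hi operator \<Rightarrow> 'ho operator"
    and \<gamma>\<^sub>i \<gamma>\<^sub>o :: complex
    and S\<^sub>i :: "'hi operator set" and S\<^sub>o :: "'ho operator set"
  assumes "clinear P\<^sub>i" and "clinear P\<^sub>o"
    and "P\<^sub>i \<circ> P\<^sub>i = P\<^sub>i" and "P\<^sub>o \<circ> P\<^sub>o = P\<^sub>o"
    and "\<gamma>\<^sub>i \<noteq> 0"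
    and "S\<^sub>i = {W. P\<^sub>i W = W \<and> tr W = \<gamma>\<^sub>i}"
    and "S\<^sub>o = {W'. P\<^sub>o W' = W' \<and> tr W' = \<gamma>\<^sub>o}"
    and "S\<^sub>i \<noteq> {}"
    and "clinear T"
  shows "(\<forall>W\<in>S\<^sub>i. T W \<in> S\<^sub>o) \<longleftrightarrow>
    P\<^sub>o \<circ> T \<circ> P\<^sub>i = T \<circ> P\<^sub>i \<and>
    tr \<circ> T \<circ> P\<^sub>i = (\<lambda>X. \<gamma>\<^sub>o / \<gamma>\<^sub>i * (tr \<circ> P\<^sub>i) X)"
proof (intro iffI conjI)
  assume maps: "\<forall>W\<in>S\<^sub>i. T W \<in> S\<^sub>o"
  obtain W0 where W0: "W0 \<in> S\<^sub>i"
    using \<open>S\<^sub>i \<noteq> {}\<close> by blast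
  then have TW0: "P\<^sub>o (T W0) = T W0" "tr (T W0) = \<gamma>\<^sub>o"
    using maps assms(7) by auto
  have range: "P\<^sub>o (T (P\<^sub>i X)) = T (P\<^sub>i X) \<and> tr (T (P\<^sub>i X)) = \<gamma>\<^sub>o / \<gamma>\<^sub>i * tr (P\<^sub>i X)" for X
  proof -
    \<comment> \<open>Here \<open>Y\<close> is the shifted point. Since
      \<open>tr W0 = \<gamma>\<^sub>i\<close>, this \<open>c\<close> supplies exactly the trace that
      \<open>P\<^sub>i X\<close> lacks; it may be zero.\<close>
    define c where "c = 1 - tr (P\<^sub>i X) / \<gamma>\<^sub>i"
    define Y where "Y = P\<^sub>i X + c *\<^sub>C W0"
    have "P\<^sub>i (P\<^sub>i X) = P\<^sub>i X"
      using assms(3) by (metis comp_apply)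
    then have "P\<^sub>i Y = Y"
      using W0 assms(6) by (simp add: Y_def clinear_add[OF assms(1)] clinear_scaleC[OF assms(1)])
    moreover have "tr Y = \<gamma>\<^sub>i"
      using W0 assms(5,6) by (simp add: Y_def c_def tr_add tr_scaleC field_simps)
    ultimately have "T Y \<in> S\<^sub>o"
      using maps assms(6) by blast
    moreover have TY: "T Y = T (P\<^sub>i X) + c *\<^sub>C T W0"
      by (simp add: Y_def clinear_add[OF assms(9)] clinear_scaleC[OF assms(9)])
    \<comment> \<open>Both \<open>T Y\<close> and \<open>T W0\<close> lie in
      \<open>S\<^sub>o\<close>. Expanding the two conditions on \<open>T Y\<close> by linearity
      leaves the \<open>W0\<close> terms explicit, ready to cancel.\<close>
    ultimately have "P\<^sub>o (T (P\<^sub>i X)) + c *\<^sub>C T W0 = T (P\<^sub>i X) + c *\<^sub>C T W0"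
      and tr_TY: "tr (T (P\<^sub>i X)) + c * \<gamma>\<^sub>o = \<gamma>\<^sub>o"
      using TW0 assms(7)
      by (simp_all add: clinear_add[OF assms(2)] clinear_scaleC[OF assms(2)] tr_add tr_scaleC)
    \<comment> \<open>By the choice of \<open>c\<close>, \<open>(1 - c) * \<gamma>\<^sub>o\<close>
      is the claimed multiple of \<open>tr (P\<^sub>i X)\<close>.\<close>
    moreover have "tr (T (P\<^sub>i X)) = \<gamma>\<^sub>o / \<gamma>\<^sub>i * tr (P\<^sub>i X)"
      using tr_TY by (simp add: c_def algebra_simps)
    ultimately show ?thesis
      by simp
  qed
  show "P\<^sub>o \<circ> T \<circ> P\<^sub>i = T \<circ> P\<^sub>i" "tr \<circ> T \<circ> P\<^sub>i = (\<lambda>X. \<gamma>\<^sub>o / \<gamma>\<^sub>i * (tr \<circ> P\<^sub>i) X)"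
    using range by (simp_all add: fun_eq_iff)
next
  assume "P\<^sub>o \<circ> T \<circ> P\<^sub>i = T \<circ> P\<^sub>i \<and> tr \<circ> T \<circ> P\<^sub>i = (\<lambda>X. \<gamma>\<^sub>o / \<gamma>\<^sub>i * (tr \<circ> P\<^sub>i) X)"
  then have range: "P\<^sub>o (T (P\<^sub>i X)) = T (P\<^sub>i X)" "tr (T (P\<^sub>i X)) = \<gamma>\<^sub>o / \<gamma>\<^sub>i * tr (P\<^sub>i X)" for X
    by (simp_all add: fun_eq_iff)
  show "\<forall>W\<in>S\<^sub>i. T W \<in> S\<^sub>o"
  proof
    fix W
    assume "W \<in> S\<^sub>i"
    then show "T W \<in> S\<^sub>o"
      \<comment> \<open>Since \<open>P\<^sub>i W = W\<close>, the identities at \<open>X = W\<close>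
        speak about \<open>T W\<close> itself, and \<open>tr W = \<gamma>\<^sub>i\<close> cancels
        the nonzero denominator.\<close>
      using range[of W] assms(5-7) by simp
  qed
qed

end
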